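(* Let $k\ge 3$ and let $F$ be a $k$-graph. Suppose that there exist $r\in\mathbb N$ and a set $\mathscr P\subseteq [r]^{k}$ (the set of $k$-tuples with entries in $[r]=\{1,\dots,r\}$) with the following property: for every $n\in\mathbb N$ and every map $\psi:\binom{[n]}{k-1}\to[r]$ (defined on the $(k-1)$-element subsets of $[n]$), the $k$-graph $H$ with vertex set $[n]$ and edge set \[ E(H)=\Big\{e=\{i_1<i_2<\dots<i_k\}\subseteq[n]:\ \big(\psi(e\setminus\{i_1\}),\psi(e\setminus\{i_2\}),\dots,\psi(e\setminus\{i_k\})\big)\in\mathscr P\Big\} \] is $F$-free. Then $\pi_{k-2}(F)\ge |\mathscr P|/r^k$.
   Context: A $k$-graph is a pair $H=(V,E)$ with $E$ a set of $k$-element subsets of the finite set $V$; $H$ is $F$-free if it contains no subhypergraph isomorphic to $F$. For an integer $0\le j<k$ and a $j$-graph $G$ on vertex set $V$, let $\mathcal K_k(G)$ denote the set of $k$-subsets of $V$ all of whose $j$-subsets are edges of $G$ (for $j=0$ there are two $0$-graphs: with empty edge set, or with the empty set as an edge). Given $d\in[0,1]$ and $\mu>0$, a $k$-graph $H=(V,E)$ with $n$ vertices is $(d,\mu,j)$-dense if $|\mathcal K_k(G)\cap E|\ge d|\mathcal K_k(G)|-\mu n^k$ for every $j$-graph $G$ with vertex set $V$. For a $k$-graph $F$, $\pi_j(F)$ is the supremum of all $d\in[0,1]$ such that for every $\mu>0$ and every $n_0\in\mathbb N$ there exists an $F$-free $(d,\mu,j)$-dense $k$-graph $H$ with at least $n_0$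 vertices. *)

theory Defs
  imports Complex_Main "HOL-Library.Ramsey" "HOL-Library.FuncSet"
begin

type_synonym 'a hypergraph = "'a set \<times> 'a set set"

abbreviation verts :: "'a hypergraph \<Rightarrow> 'a set" where
  "verts H \<equiv> fst H"

abbreviation edges :: "'a hypergraph \<Rightarrow> 'a set set" where
  "edges H \<equiv> snd H"

definition kgraph :: "nat \<Rightarrow> 'a hypergraph \<Rightarrow> bool" where
  "kgraph k H \<longleftrightarrow> finite (verts H) \<and> edges H \<subseteq> nsets (verts H) k"

definition subhypergraph :: "nat \<Rightarrow> 'a hypergraph \<Rightarrow> 'a hypergraph \<Rightarrow> bool" where
  "subhypergraph k H' H \<longleftrightarrow>
     kgraph k H' \<and> verts H' \<subseteq> verts H \<and> edges H' \<subseteq> edges H"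

definition isomorphic :: "'a hypergraph \<Rightarrow> 'b hypergraph \<Rightarrow> bool" where
  "isomorphic F H \<longleftrightarrow>
     (\<exists>f. bij_betw f (verts F) (verts H) \<and> edges H = (\<lambda>e. f ` e) ` edges F)"

definition free_of :: "nat \<Rightarrow> 'a hypergraph \<Rightarrow> 'b hypergraph \<Rightarrow> bool" where
  "free_of k F H \<longleftrightarrow> \<not> (\<exists>H'. subhypergraph k H' H \<and> isomorphic F H')"

definition cliques :: "nat \<Rightarrow> nat \<Rightarrow> 'a hypergraph \<Rightarrow> 'a set set" where
  "cliques k j G = {S \<in> nsets (verts G) k. nsets S j \<subseteq> edges G}"

definition dense :: "nat \<Rightarrow> real \<Rightarrow> real \<Rightarrow> nat \<Rightarrow> 'a hypergraph \<Rightarrow> bool" where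
  "dense k d \<mu> j H \<longleftrightarrow>
     (\<forall>G. kgraph j G \<and> verts G = verts H \<longrightarrow>
        real (card (cliques k j G \<inter> edges H))
          \<ge> d * real (card (cliques k j G)) - \<mu> * real (card (verts H)) ^ k)"

text \<open>The host hypergraphs range over finite sets of natural numbers; up to isomorphism these are
  all finite hypergraphs. The set below is empty (and the supremum then unspecified) exactly when
  \<open>F\<close> has no edges.\<close>

definition uniform_turan_density :: "nat \<Rightarrow> nat \<Rightarrow> 'a hypergraph \<Rightarrow> real" where
  "uniform_turan_density k j F =
     Sup {d. 0 \<le> d \<and> d \<le> 1 \<and>
       (\<forall>\<mu>>0. \<forall>n\<^sub>0. \<exists>H :: nat hypergraph.
          kgraph k H \<and> card (verts H) \<ge> n\<^sub>0 \<and> free_of k F H \<and> dense k d \<mu> j H)}"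

definition palette_hypergraph ::
    "nat \<Rightarrow> nat list set \<Rightarrow> nat \<Rightarrow> (nat set \<Rightarrow> nat) \<Rightarrow> nat hypergraph" where
  "palette_hypergraph k P n \<psi> =
     ({1..n}, {e \<in> nsets {1..n} k. map (\<lambda>i. \<psi> (e - {i})) (sorted_list_of_set e) \<in> P})"

end

theory Submission
  imports Defs "HOL-Probability.Product_PMF" "HOL-Probability.Hoeffding"
begin

text \<open>Colour the \<open>(k - 1)\<close>-subsets of \<open>{1..n}\<close> independently and uniformly at random. The \<open>k\<close> colours
  seen by a \<open>k\<close>-set are independent, so the expected number of edges of the palette hypergraph
  among the \<open>k\<close>-cliques of a fixed \<open>(k - 2)\<close>-graph \<open>G\<close> is \<open>|P| / r ^ k\<close> times the number of cliques.
  Recolouring one \<open>(k - 1)\<close>-set changes this number by at most \<open>n\<close>, so by McDiarmid's inequality it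
  falls \<open>\<mu> n ^ k\<close> below its mean with probability at most \<open>exp (- 2 \<mu>\<^sup>2 n ^ (k - 1))\<close>, which beats the
  at most \<open>2 ^ (n ^ (k - 2))\<close> choices of \<open>G\<close> once \<open>n\<close> is large.\<close>

section \<open>McDiarmid's inequality\<close>

lemma expectation_bind_pmf:
  fixes f :: "'b \<Rightarrow> real"
  assumes bounded: "\<And>y. y \<in> set_pmf (bind_pmf p q) \<Longrightarrow> \<bar>f y\<bar> \<le> B"
  shows "measure_pmf.expectation (bind_pmf p q) f
       = measure_pmf.expectation p (\<lambda>x. measure_pmf.expectation (q x) f)"
proof -
  define f' where "f' y = (if y \<in> set_pmf (bind_pmf p q) then f y else 0)" for y
  have "\<bar>f' y\<bar> \<le> \<bar>B\<bar>" for y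
    using bounded[of y] unfolding f'_def by (smt (verit))
  then have "measure_pmf.expectation (bind_pmf p q) f'
      = measure_pmf.expectation p (\<lambda>x. measure_pmf.expectation (q x) f')"
    using measurable_measure_pmf[of q] unfolding measure_pmf_bind
    by (intro integral_bind[where K = "count_space UNIV" and B' = 1])
      (auto simp: measure_pmf.emeasure_space_1 measure_pmf.finite_measure_axioms)
  moreover have "measure_pmf.expectation (bind_pmf p q) f'
      = measure_pmf.expectation (bind_pmf p q) f"
    by (intro integral_cong_AE) (auto simp: f'_def AE_measure_pmf_iff)
  moreover have "measure_pmf.expectation p (\<lambda>x. measure_pmf.expectation (q x) f')
      = measure_pmf.expectation p (\<lambda>x. measure_pmf.expectation (q x) f)"
    by (intro integral_cong_AE) (auto simp: f'_def AE_measure_pmf_iff intro!: integral_cong_AE)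
  ultimately show ?thesis by simp
qed

lemma Hoeffdings_lemma_oscillation:
  fixes h :: "'a \<Rightarrow> real"
  assumes oscillation: "\<And>y z. \<bar>h y - h z\<bar> \<le> c" and "l > 0"
  shows "(\<integral>\<^sup>+y. ennreal (exp (l * (h y - measure_pmf.expectation p h))) \<partial>measure_pmf p)
       \<le> ennreal (exp (l\<^sup>2 * c\<^sup>2 / 8))"
proof -
  define a where "a = (INF y. h y)"
  have below: "bdd_below (range h)"
    using oscillation[of undefined]
    by (intro bdd_belowI[of _ "h undefined - c"]) (auto simp: abs_le_iff algebra_simps)
  have "a \<le> h y" for y
    unfolding a_def by (intro cINF_lower below) simp
  moreover have "h y \<le> a + c" for y
  proof -
    have "h y - c \<le> a"
      unfolding a_def using oscillation[of y]
      by (intro cINF_greatest) (auto simp: abs_le_iff algebra_simps)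
    then show ?thesis by simp
  qed
  ultimately interpret interval_bounded_random_variable "measure_pmf p" h a "a + c"
    by unfold_locales auto
  show ?thesis
    using Hoeffdings_lemma_nn_integral[OF \<open>l > 0\<close>] by simp
qed

definition bounded_differences :: "'i set \<Rightarrow> ('i \<Rightarrow> real) \<Rightarrow> (('i \<Rightarrow> 'a) \<Rightarrow> real) \<Rightarrow> bool" where
  "bounded_differences A c f \<longleftrightarrow> (\<forall>x\<in>A. \<forall>g y. \<bar>f (g(x := y)) - f g\<bar> \<le> c x)"

lemma bounded_differencesI:
  assumes upper: "\<And>x g y. x \<in> A \<Longrightarrow> f (g(x := y)) \<le> f g + c x"
  shows "bounded_differences A c f"
  unfolding bounded_differences_def
proof (intro ballI allI)
  fix x g y assume "x \<in> A"
  then show "\<bar>f (g(x := y)) - f g\<bar> \<le> c x"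
    using upper[of x g y] upper[of x "g(x := y)" "g x"] by simp
qed

lemma bounded_differencesD:
  "bounded_differences A c f \<Longrightarrow> x \<in> A \<Longrightarrow> \<bar>f (g(x := y)) - f (g(x := z))\<bar> \<le> c x"
  unfolding bounded_differences_def by (metis fun_upd_upd)

lemma bounded_differences_uminus:
  "bounded_differences A c f \<Longrightarrow> bounded_differences A c (\<lambda>g. - f g)"
  unfolding bounded_differences_def by (simp add: abs_minus_commute)

lemma bounded_differences_fun_upd:
  assumes "bounded_differences (insert x A) c f" "x \<notin> A"
  shows "bounded_differences A c (\<lambda>g. f (g(x := y)))"
  unfolding bounded_differences_def
proof (intro ballI allI)
  fix z g v assume "z \<in> A"
  then have "(g(z := v))(x := y) = (g(x := y))(z := v)"
    using \<open>x \<notin> A\<close> by (intro fun_upd_twist) auto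
  then show "\<bar>f ((g(z := v))(x := y)) - f (g(x := y))\<bar> \<le> c z"
    using assms(1) \<open>z \<in> A\<close> by (simp add: bounded_differences_def)
qed

lemma bounded_differences_abs_diff_le_sum:
  assumes "finite A" "bounded_differences A c f" "\<And>x. x \<notin> A \<Longrightarrow> g x = h x"
  shows "\<bar>f g - f h\<bar> \<le> sum c A"
  using assms
proof (induction A arbitrary: g rule: finite_induct)
  case empty
  then have "g = h" by auto
  then show ?case by simp
next
  case (insert x A)
  have "bounded_differences A c f"
    using insert.prems(1) by (simp add: bounded_differences_def)
  then have "\<bar>f (g(x := h x)) - f h\<bar> \<le> sum c A"
    using insert.prems(2) by (intro insert.IH) auto
  moreover have "\<bar>f (g(x := h x)) - f g\<bar> \<le> c x"
    using insert.prems(1) by (simp add: bounded_differences_def)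
  ultimately show ?case
    using insert.hyps by simp
qed

lemma abs_le_Pi_pmf_bounded_differences:
  assumes "finite A" "bounded_differences A c f" "g \<in> set_pmf (Pi_pmf A d p)"
  shows "\<bar>f g\<bar> \<le> \<bar>f (\<lambda>_. d)\<bar> + sum c A"
proof -
  have "g x = d" if "x \<notin> A" for x
    using assms(1,3) set_Pi_pmf_subset[of A d p] that by blast
  then have "\<bar>f g - f (\<lambda>_. d)\<bar> \<le> sum c A"
    by (rule bounded_differences_abs_diff_le_sum[OF assms(1,2)])
  then show ?thesis by linarith
qed

lemma integrable_Pi_pmf_bounded_differences:
  assumes "finite A" "bounded_differences A c f"
  shows "integrable (measure_pmf (Pi_pmf A d p)) f"
  using abs_le_Pi_pmf_bounded_differences[OF assms]
  by (intro measure_pmf.integrable_const_bound) (auto simp: AE_measure_pmf_iff)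

lemma expectation_Pi_pmf_insert:
  assumes "finite A" "x \<notin> A" "bounded_differences (insert x A) c f"
  shows "measure_pmf.expectation (Pi_pmf (insert x A) d p) f
       = measure_pmf.expectation (p x)
           (\<lambda>y. measure_pmf.expectation (Pi_pmf A d p) (\<lambda>g. f (g(x := y))))"
proof -
  have bind: "Pi_pmf (insert x A) d p
      = bind_pmf (p x) (\<lambda>y. map_pmf (\<lambda>g. g(x := y)) (Pi_pmf A d p))"
    using assms(1,2) by (simp add: Pi_pmf_insert' map_pmf_def)
  have "\<bar>f g\<bar> \<le> \<bar>f (\<lambda>_. d)\<bar> + sum c (insert x A)"
    if "g \<in> set_pmf (Pi_pmf (insert x A) d p)" for g
    using that assms by (intro abs_le_Pi_pmf_bounded_differences) auto
  then show ?thesis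
    unfolding bind by (subst expectation_bind_pmf) auto
qed

lemma expectation_Pi_pmf_fun_upd_oscillation:
  assumes "finite A" "x \<notin> A" "bounded_differences (insert x A) c f"
  shows "\<bar>measure_pmf.expectation (Pi_pmf A d p) (\<lambda>g. f (g(x := y)))
          - measure_pmf.expectation (Pi_pmf A d p) (\<lambda>g. f (g(x := z)))\<bar> \<le> c x"
proof -
  let ?E = "measure_pmf.expectation (Pi_pmf A d p)"
  have integrable: "integrable (Pi_pmf A d p) (\<lambda>g. f (g(x := y)))" for y
    using assms bounded_differences_fun_upd by (intro integrable_Pi_pmf_bounded_differences)
  then have "?E (\<lambda>g. f (g(x := y))) - ?E (\<lambda>g. f (g(x := z)))
      = ?E (\<lambda>g. f (g(x := y)) - f (g(x := z)))"
    by simp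
  also have "\<bar>\<dots>\<bar> \<le> ?E (\<lambda>g. \<bar>f (g(x := y)) - f (g(x := z))\<bar>)"
    by (rule integral_abs_bound)
  also have "\<dots> \<le> c x"
    using integrable
    by (intro measure_pmf.integral_le_const AE_I2 bounded_differencesD[OF assms(3)]) auto
  finally show ?thesis .
qed

text \<open>Integrate over the coordinate \<open>x\<close> last: the induction hypothesis applies to each slice
  \<open>\<lambda>g. f (g(x := y))\<close>, and Hoeffding's lemma to the mean of the slice as a function of \<open>y\<close>.\<close>

lemma bounded_differences_mgf_le:
  fixes f :: "('i \<Rightarrow> 'a) \<Rightarrow> real"
  assumes "finite A" "bounded_differences A c f" "l > 0"
  shows "(\<integral>\<^sup>+g. ennreal (exp (l * (f g - measure_pmf.expectation (Pi_pmf A d p) f)))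
            \<partial>measure_pmf (Pi_pmf A d p))
       \<le> ennreal (exp (l\<^sup>2 * (\<Sum>x\<in>A. (c x)\<^sup>2) / 8))"
  using assms(1,2)
proof (induction A arbitrary: f rule: finite_induct)
  case empty
  then show ?case by simp
next
  case (insert x A)
  let ?Pi = "Pi_pmf A d p"
  define m where "m = measure_pmf.expectation (Pi_pmf (insert x A) d p) f"
  define h where "h y = measure_pmf.expectation ?Pi (\<lambda>g. f (g(x := y)))" for y
  have slice: "bounded_differences A c (\<lambda>g. f (g(x := y)))" for y
    using insert by (intro bounded_differences_fun_upd)
  have mean: "m = measure_pmf.expectation (p x) h"
    unfolding m_def h_def using insert by (intro expectation_Pi_pmf_insert)
  have oscillation: "\<bar>h y - h z\<bar> \<le> c x" for y z
    unfolding h_def using insert by (intro expectation_Pi_pmf_fun_upd_oscillation)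
  have "(\<integral>\<^sup>+g. ennreal (exp (l * (f g - m))) \<partial>measure_pmf (Pi_pmf (insert x A) d p))
      = (\<integral>\<^sup>+y. \<integral>\<^sup>+g. ennreal (exp (l * (f (g(x := y)) - m))) \<partial>?Pi \<partial>p x)"
    using insert.hyps by (simp add: Pi_pmf_insert nn_integral_pair_pmf')
  also have "\<dots> = (\<integral>\<^sup>+y. ennreal (exp (l * (h y - m)))
      * (\<integral>\<^sup>+g. ennreal (exp (l * (f (g(x := y)) - h y))) \<partial>?Pi) \<partial>p x)"
    by (simp add: algebra_simps flip: nn_integral_cmult ennreal_mult exp_add)
  also have "\<dots> \<le> (\<integral>\<^sup>+y. ennreal (exp (l * (h y - m)))
      * ennreal (exp (l\<^sup>2 * (\<Sum>x\<in>A. (c x)\<^sup>2) / 8)) \<partial>p x)"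
    unfolding h_def by (intro nn_integral_mono mult_left_mono insert.IH slice) simp
  also have "\<dots> = (\<integral>\<^sup>+y. ennreal (exp (l * (h y - m))) \<partial>p x)
      * ennreal (exp (l\<^sup>2 * (\<Sum>x\<in>A. (c x)\<^sup>2) / 8))"
    by (intro nn_integral_multc) simp
  also have "\<dots> \<le> ennreal (exp (l\<^sup>2 * (c x)\<^sup>2 / 8)) * ennreal (exp (l\<^sup>2 * (\<Sum>x\<in>A. (c x)\<^sup>2) / 8))"
    unfolding mean by (intro mult_right_mono Hoeffdings_lemma_oscillation oscillation \<open>l > 0\<close>) simp
  also have "\<dots> = ennreal (exp (l\<^sup>2 * (\<Sum>x\<in>insert x A. (c x)\<^sup>2) / 8))"
    using insert.hyps
    by (simp add: algebra_simps add_divide_distrib flip: ennreal_mult exp_add)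
  finally show ?case unfolding m_def .
qed

theorem McDiarmid_ineq_ge:
  fixes f :: "('i \<Rightarrow> 'a) \<Rightarrow> real" and d :: 'a and p :: "'i \<Rightarrow> 'a pmf"
  assumes "finite A" "bounded_differences A c f" "t \<ge> 0"
  defines "M \<equiv> Pi_pmf A d p"
  shows "measure_pmf.prob M {g. f g \<ge> measure_pmf.expectation M f + t}
       \<le> exp (- 2 * t\<^sup>2 / (\<Sum>x\<in>A. (c x)\<^sup>2))"
proof -
  define v where "v = (\<Sum>x\<in>A. (c x)\<^sup>2)"
  show ?thesis
  proof (cases "t = 0 \<or> v = 0") \<comment> \<open>since \<open>t\<^sup>2 / 0 = 0\<close>, the bound is then \<open>1\<close>\<close>
    case True
    then show ?thesis by (auto simp flip: v_def)
  next
    case False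
    then have "t > 0" "v > 0"
      using \<open>t \<ge> 0\<close> by (auto simp: v_def sum_nonneg less_le)
    define l where "l = 4 * t / v" \<comment> \<open>minimises the exponent \<open>l\<^sup>2 * v / 8 - l * t\<close>\<close>
    have "l > 0"
      using \<open>t > 0\<close> \<open>v > 0\<close> by (simp add: l_def)
    let ?m = "measure_pmf.expectation M f"
    have "ennreal (measure_pmf.prob M {g. f g \<ge> ?m + t}) = emeasure M {g \<in> UNIV. f g - ?m \<ge> t}"
      by (simp add: measure_pmf.emeasure_eq_measure algebra_simps)
    also have "\<dots> \<le> ennreal (exp (- l * t))
        * (\<integral>\<^sup>+g. ennreal (exp (l * (f g - ?m))) * indicator UNIV g \<partial>M)"
      by (intro Chernoff_ineq_nn_integral_ge \<open>l > 0\<close>) auto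
    also have "\<dots> \<le> ennreal (exp (- l * t)) * ennreal (exp (l\<^sup>2 * v / 8))"
      unfolding M_def v_def
      using bounded_differences_mgf_le[OF assms(1,2) \<open>l > 0\<close>] by (intro mult_left_mono) auto
    also have "\<dots> = ennreal (exp (- 2 * t\<^sup>2 / v))"
      using \<open>v > 0\<close>
      by (simp add: l_def power2_eq_square field_simps flip: ennreal_mult exp_add)
    finally show ?thesis by (simp add: v_def)
  qed
qed

corollary McDiarmid_ineq_le:
  fixes f :: "('i \<Rightarrow> 'a) \<Rightarrow> real" and d :: 'a and p :: "'i \<Rightarrow> 'a pmf"
  assumes "finite A" "bounded_differences A c f" "t \<ge> 0"
  defines "M \<equiv> Pi_pmf A d p"
  shows "measure_pmf.prob M {g. f g \<le> measure_pmf.expectation M f - t}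
       \<le> exp (- 2 * t\<^sup>2 / (\<Sum>x\<in>A. (c x)\<^sup>2))"
  using McDiarmid_ineq_ge[OF assms(1) bounded_differences_uminus[OF assms(2)] assms(3), of d p]
  unfolding M_def by (simp add: algebra_simps)

section \<open>Discrete uniform distributions and the union bound\<close>

lemma pmf_replicate_pmf: "pmf (replicate_pmf (length xs) p) xs = (\<Prod>x\<leftarrow>xs. pmf p x)"
proof (induction xs)
  case (Cons x xs)
  have "replicate_pmf (length (x # xs)) p
      = map_pmf (\<lambda>(y, ys). y # ys) (pair_pmf p (replicate_pmf (length xs) p))"
    by (simp add: pair_pmf_def map_bind_pmf)
  then have "pmf (replicate_pmf (length (x # xs)) p) (x # xs)
      = pmf (pair_pmf p (replicate_pmf (length xs) p)) (x, xs)"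
    using pmf_map_inj'[of "\<lambda>(y, ys). y # ys" _ "(x, xs)"] by (simp add: inj_def)
  then show ?case
    using Cons.IH by (simp add: pmf_pair)
qed simp

lemma prob_replicate_pmf_of_set:
  assumes "finite S" "S \<noteq> {}" "P \<subseteq> {xs. length xs = n \<and> set xs \<subseteq> S}"
  shows "measure_pmf.prob (replicate_pmf n (pmf_of_set S)) P = card P / card S ^ n"
proof -
  have "finite {xs. set xs \<subseteq> S \<and> length xs = n}"
    using assms(1) by (rule finite_lists_length_eq)
  then have "finite P"
    using assms(3) by (elim finite_subset[rotated]) auto
  have "pmf (replicate_pmf n (pmf_of_set S)) xs = (1 / card S) ^ n" if "xs \<in> P" for xs
  proof -
    have xs: "length xs = n" "set xs \<subseteq> S"
      using that assms(3) by auto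
    then have "map (pmf (pmf_of_set S)) xs = replicate n (1 / card S)"
      using assms(1,2) by (intro replicate_eqI) auto
    then show ?thesis
      using pmf_replicate_pmf[of xs "pmf_of_set S"] xs(1) by simp
  qed
  then show ?thesis
    using \<open>finite P\<close> by (simp add: measure_measure_pmf_finite power_one_over)
qed

lemma map_pmf_list_Pi_pmf:
  assumes "finite A" "distinct xs" "set xs \<subseteq> A"
  shows "map_pmf (\<lambda>g. map g xs) (Pi_pmf A d (\<lambda>_. p)) = replicate_pmf (length xs) p"
  using assms
proof (induction xs arbitrary: A)
  case (Cons x xs)
  define B where "B = A - {x}"
  have "A = insert x B" "x \<notin> B" "finite B"
    using Cons.prems by (auto simp: B_def)
  have map_upd: "map (g(x := y)) xs = map g xs" for g :: "'a \<Rightarrow> 'b" and y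
    using Cons.prems(2) by simp
  have "map_pmf (\<lambda>g. map g (x # xs)) (Pi_pmf A d (\<lambda>_. p))
      = do {y \<leftarrow> p; g \<leftarrow> Pi_pmf B d (\<lambda>_. p); return_pmf (y # map g xs)}"
    unfolding \<open>A = insert x B\<close> using \<open>x \<notin> B\<close> \<open>finite B\<close>
    by (simp add: Pi_pmf_insert' map_bind_pmf map_upd del: map_fun_upd)
  also have "\<dots> = do {y \<leftarrow> p; ys \<leftarrow> map_pmf (\<lambda>g. map g xs) (Pi_pmf B d (\<lambda>_. p));
      return_pmf (y # ys)}"
    by (simp add: bind_map_pmf)
  also have "map_pmf (\<lambda>g. map g xs) (Pi_pmf B d (\<lambda>_. p)) = replicate_pmf (length xs) p"
    using Cons.prems \<open>finite B\<close> by (intro Cons.IH) (auto simp: B_def)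
  finally show ?case by simp
qed simp

lemma obtain_avoiding_union_bound:
  assumes "finite I" "(\<Sum>i\<in>I. measure_pmf.prob p (B i)) < 1"
  obtains x where "x \<in> set_pmf p" "\<And>i. i \<in> I \<Longrightarrow> x \<notin> B i"
proof -
  have "measure_pmf.prob p (\<Union>i\<in>I. B i) < 1"
    using measure_pmf.finite_measure_subadditive_finite[OF assms(1), of B p] assms(2) by simp
  moreover have "measure_pmf.prob p (\<Union>i\<in>I. B i) = 1" if "set_pmf p \<subseteq> (\<Union>i\<in>I. B i)"
    using that by (subst measure_pmf.prob_eq_1) (auto simp: AE_measure_pmf_iff)
  ultimately show thesis
    using that by fastforce
qed

section \<open>Palette hypergraphs\<close>

definition deletions :: "'a::linorder set \<Rightarrow> 'a set list" where
  "deletions e = map (\<lambda>i. e - {i}) (sorted_list_of_set e)"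

lemma distinct_deletions: "finite e \<Longrightarrow> distinct (deletions e)"
  by (auto simp: deletions_def distinct_map inj_on_def)

lemma length_deletions [simp]: "length (deletions e) = card e"
  by (simp add: deletions_def)

lemma set_deletions: "finite e \<Longrightarrow> set (deletions e) = (\<lambda>i. e - {i}) ` e"
  by (simp add: deletions_def)

lemma set_deletions_subset_nsets: "e \<in> nsets V k \<Longrightarrow> set (deletions e) \<subseteq> nsets V (k - 1)"
  by (auto simp: set_deletions nsets_def)

lemma verts_palette_hypergraph [simp]: "verts (palette_hypergraph k P n \<psi>) = {1..n}"
  by (simp add: palette_hypergraph_def)

lemma edges_palette_hypergraph:
  "edges (palette_hypergraph k P n \<psi>) = {e \<in> nsets {1..n} k. map \<psi> (deletions e) \<in> P}"
  by (simp add: palette_hypergraph_def deletions_def o_def)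

lemma kgraph_palette_hypergraph: "kgraph k (palette_hypergraph k P n \<psi>)"
  by (auto simp: kgraph_def edges_palette_hypergraph)

definition clique_families :: "nat \<Rightarrow> nat \<Rightarrow> 'a set \<Rightarrow> 'a set set set" where
  "clique_families k j V = {cliques k j G |G. kgraph j G \<and> verts G = V}"

lemma clique_families_subset_nsets: "K \<in> clique_families k j V \<Longrightarrow> K \<subseteq> nsets V k"
  by (auto simp: clique_families_def cliques_def)

lemma
  assumes "finite V"
  shows finite_clique_families: "finite (clique_families k j V)"
    and card_clique_families_le: "card (clique_families k j V) \<le> 2 ^ (card V choose j)"
proof -
  have sub: "clique_families k j V \<subseteq> (\<lambda>E. cliques k j (V, E)) ` Pow (nsets V j)"
    by (force simp: clique_families_def kgraph_def)
  have fin: "finite (Pow (nsets V j))"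
    using assms by (simp add: finite_imp_finite_nsets)
  show "finite (clique_families k j V)"
    using sub fin by (meson finite_imageI finite_subset)
  show "card (clique_families k j V) \<le> 2 ^ (card V choose j)"
    using surj_card_le[OF fin sub] assms by (simp add: card_Pow finite_imp_finite_nsets)
qed

lemma dense_iff_clique_families:
  "dense k d \<mu> j H \<longleftrightarrow> (\<forall>K\<in>clique_families k j (verts H).
     real (card (K \<inter> edges H)) \<ge> d * real (card K) - \<mu> * real (card (verts H)) ^ k)"
  unfolding dense_def clique_families_def by blast

lemma two_power_mult_exp_less_1:
  fixes c :: real
  assumes "1 < c * real n"
  shows "2 ^ (n ^ m) * exp (- c * real n ^ Suc m) < 1"
proof -
  have "n > 0"
    using assms by (cases n) auto
  have "(2::real) ^ (n ^ m) \<le> exp 1 ^ (n ^ m)"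
    using exp_ge_add_one_self[of 1] by (intro power_mono) auto
  also have "\<dots> = exp (real n ^ m)"
    by (simp flip: exp_of_nat_mult)
  finally have "2 ^ (n ^ m) * exp (- c * real n ^ Suc m) \<le> exp (real n ^ m * (1 - c * real n))"
    by (simp add: algebra_simps exp_diff exp_minus divide_simps)
  also have "\<dots> < 1"
    using assms \<open>n > 0\<close> by (simp add: mult_pos_neg)
  finally show ?thesis .
qed

lemma uniform_turan_density_geI:
  assumes "0 \<le> d" "d \<le> 1"
    and "\<And>\<mu> n. \<mu> > 0 \<Longrightarrow> \<exists>H :: nat hypergraph.
      kgraph k H \<and> card (verts H) \<ge> n \<and> free_of k F H \<and> dense k d \<mu> j H"
  shows "d \<le> uniform_turan_density k j F"
  unfolding uniform_turan_density_def
  using assms by (intro cSup_upper bdd_aboveI[of _ 1]) auto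

locale palette =
  fixes k r :: nat and P :: "nat list set"
  assumes colours: "r \<ge> 1"
    and patterns: "P \<subseteq> {xs. length xs = k \<and> set xs \<subseteq> {1..r}}"
begin

definition pattern_density :: real where
  "pattern_density = card P / real r ^ k"

definition random_colouring :: "nat \<Rightarrow> (nat set \<Rightarrow> nat) pmf" where
  "random_colouring n = Pi_pmf (nsets {1..n} (k - 1)) undefined (\<lambda>_. pmf_of_set {1..r})"

definition edge_count :: "nat \<Rightarrow> nat set set \<Rightarrow> (nat set \<Rightarrow> nat) \<Rightarrow> real" where
  "edge_count n K \<psi> = card (K \<inter> edges (palette_hypergraph k P n \<psi>))"

lemma pattern_density_eq_prob:
  "pattern_density = measure_pmf.prob (replicate_pmf k (pmf_of_set {1..r})) P"
  using colours patterns by (simp add: pattern_density_def prob_replicate_pmf_of_set)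

lemma pattern_density_nonneg: "0 \<le> pattern_density"
  and pattern_density_le_1: "pattern_density \<le> 1"
  by (simp_all add: pattern_density_eq_prob)

lemma set_random_colouring:
  assumes "\<psi> \<in> set_pmf (random_colouring n)"
  shows "\<psi> \<in> nsets {1..n} (k - 1) \<rightarrow> {1..r}"
  using assms colours
  by (auto simp: random_colouring_def set_Pi_pmf finite_imp_finite_nsets PiE_dflt_def)

lemma prob_edge:
  assumes "e \<in> nsets {1..n} k"
  shows "measure_pmf.prob (random_colouring n) {\<psi>. e \<in> edges (palette_hypergraph k P n \<psi>)}
       = pattern_density"
proof -
  have finite_card: "finite e" "card e = k"
    using assms by (auto simp: nsets_def)
  have "measure_pmf.prob (random_colouring n) {\<psi>. e \<in> edges (palette_hypergraph k P n \<psi>)}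
      = measure_pmf.prob (map_pmf (\<lambda>\<psi>. map \<psi> (deletions e)) (random_colouring n)) P"
    using assms by (simp add: edges_palette_hypergraph vimage_def)
  also have "map_pmf (\<lambda>\<psi>. map \<psi> (deletions e)) (random_colouring n)
      = replicate_pmf k (pmf_of_set {1..r})"
    unfolding random_colouring_def
    using finite_card set_deletions_subset_nsets[OF assms]
    by (simp add: map_pmf_list_Pi_pmf finite_imp_finite_nsets distinct_deletions)
  finally show ?thesis by (simp add: pattern_density_eq_prob)
qed

lemma expectation_edge_count:
  assumes "K \<subseteq> nsets {1..n} k"
  shows "measure_pmf.expectation (random_colouring n) (edge_count n K) = pattern_density * card K"
proof -
  have "finite K"
    using assms by (rule finite_subset) (simp add: finite_imp_finite_nsets)
  define X where "X e = {\<psi>. e \<in> edges (palette_hypergraph k P n \<psi>)}" for e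
  have "edge_count n K \<psi> = (\<Sum>e\<in>K. indicator (X e) \<psi>)" for \<psi>
    using \<open>finite K\<close> by (simp add: edge_count_def X_def indicator_def sum.If_cases)
  then have "measure_pmf.expectation (random_colouring n) (edge_count n K)
      = measure_pmf.expectation (random_colouring n) (\<lambda>\<psi>. \<Sum>e\<in>K. indicator (X e) \<psi>)"
    by presburger
  also have "\<dots> = (\<Sum>e\<in>K. measure_pmf.prob (random_colouring n) (X e))"
    by (subst Bochner_Integration.integral_sum) (auto simp: less_top[symmetric])
  also have "\<dots> = (\<Sum>e\<in>K. pattern_density)"
    using assms unfolding X_def by (intro sum.cong prob_edge) auto
  finally show ?thesis by simp
qed

lemma bounded_differences_edge_count:
  assumes "K \<subseteq> nsets {1..n} k"
  shows "bounded_differences A (\<lambda>_. real n) (edge_count n K)"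
proof (rule bounded_differencesI)
  fix x \<psi> c
  let ?E = "\<lambda>\<psi>. K \<inter> edges (palette_hypergraph k P n \<psi>)"
  let ?I = "(\<lambda>i. insert i x) ` {1..n}"
  have "?E (\<psi>(x := c)) \<subseteq> ?E \<psi> \<union> ?I"
  proof
    fix e assume edge: "e \<in> ?E (\<psi>(x := c))"
    show "e \<in> ?E \<psi> \<union> ?I"
    proof (cases "x \<in> set (deletions e)")
      case True
      have "finite e" "e \<subseteq> {1..n}"
        using edge assms by (auto simp: nsets_def)
      then show ?thesis
        using True by (auto simp: set_deletions insert_absorb)
    next
      case False
      then show ?thesis
        using edge by (auto simp: edges_palette_hypergraph)
    qed
  qed
  moreover have "finite (?E \<psi> \<union> ?I)"
    using finite_subset[OF assms] by (simp add: finite_imp_finite_nsets)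
  ultimately have "card (?E (\<psi>(x := c))) \<le> card (?E \<psi> \<union> ?I)"
    by (rule card_mono[rotated])
  also have "\<dots> \<le> card (?E \<psi>) + card ?I"
    by (rule card_Un_le)
  also have "\<dots> \<le> card (?E \<psi>) + n"
    using card_image_le[of "{1..n}"] by simp
  finally show "edge_count n K (\<psi>(x := c)) \<le> edge_count n K \<psi> + real n"
    by (simp add: edge_count_def)
qed

lemma prob_edge_count_lower_tail:
  assumes "1 \<le> k" "k \<le> n" "K \<subseteq> nsets {1..n} k" "0 \<le> \<mu>"
  shows "measure_pmf.prob (random_colouring n)
           {\<psi>. edge_count n K \<psi> \<le> pattern_density * card K - \<mu> * real n ^ k}
       \<le> exp (- 2 * \<mu>\<^sup>2 * real n ^ (k - 1))"
proof -
  define A where "A = nsets {1..n} (k - 1)"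
  define N where "N = real n ^ (k - 1)"
  have card_A: "0 < card A" "real (card A) \<le> N"
    using assms(1,2) binomial_le_pow[of "k - 1" n] by (simp_all add: A_def N_def flip: of_nat_power)
  have power_k: "real n ^ k = real n * N"
    using assms(1) by (simp add: N_def flip: power_Suc)
  have "measure_pmf.prob (random_colouring n)
          {\<psi>. edge_count n K \<psi> \<le> pattern_density * card K - \<mu> * real n ^ k}
      \<le> exp (- 2 * (\<mu> * real n ^ k)\<^sup>2 / (\<Sum>x\<in>A. (real n)\<^sup>2))"
    unfolding expectation_edge_count[OF assms(3), symmetric] random_colouring_def A_def
    using assms(3,4)
    by (intro McDiarmid_ineq_le bounded_differences_edge_count) (auto simp: finite_imp_finite_nsets)
  also have "\<dots> = exp (- 2 * \<mu>\<^sup>2 * (N * (N / card A)))"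
    using assms(1,2) by (simp add: power_k power2_eq_square field_simps)
  also have "\<dots> \<le> exp (- 2 * \<mu>\<^sup>2 * N)"
  proof -
    have "\<mu>\<^sup>2 * N \<le> \<mu>\<^sup>2 * (N * (N / card A))"
      using card_A by (intro mult_left_mono) (auto simp: pos_le_divide_eq mult_left_mono)
    then show ?thesis by simp
  qed
  finally show ?thesis by (simp add: N_def)
qed

lemma obtain_dense_palette_hypergraph:
  assumes "2 \<le> k" "k \<le> n" "0 \<le> \<mu>" "1 < 2 * \<mu>\<^sup>2 * real n"
  obtains \<psi> where "\<psi> \<in> nsets {1..n} (k - 1) \<rightarrow> {1..r}"
    and "dense k pattern_density \<mu> (k - 2) (palette_hypergraph k P n \<psi>)"
proof -
  let ?\<C> = "clique_families k (k - 2) {1..n}"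
  define sparse where
    "sparse K = {\<psi>. edge_count n K \<psi> \<le> pattern_density * card K - \<mu> * real n ^ k}" for K
  have "card ?\<C> \<le> 2 ^ (n choose (k - 2))"
    using card_clique_families_le[of "{1..n}"] by simp
  also have "\<dots> \<le> 2 ^ (n ^ (k - 2))"
    using assms(2) by (intro power_increasing binomial_le_pow) auto
  finally have card: "real (card ?\<C>) \<le> 2 ^ (n ^ (k - 2))"
    by (metis of_nat_le_iff of_nat_numeral of_nat_power)
  have "(\<Sum>K\<in>?\<C>. measure_pmf.prob (random_colouring n) (sparse K))
      \<le> (\<Sum>K\<in>?\<C>. exp (- 2 * \<mu>\<^sup>2 * real n ^ (k - 1)))"
    unfolding sparse_def using assms
    by (intro sum_mono prob_edge_count_lower_tail clique_families_subset_nsets) auto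
  also have "\<dots> \<le> 2 ^ (n ^ (k - 2)) * exp (- (2 * \<mu>\<^sup>2) * real n ^ Suc (k - 2))"
  proof -
    have "k - 1 = Suc (k - 2)"
      using assms(1) by simp
    then show ?thesis
      using card by (simp only: sum_constant mult_right_mono exp_ge_zero mult_minus_left)
  qed
  also have "\<dots> < 1"
    using assms(4) by (rule two_power_mult_exp_less_1)
  finally obtain \<psi> where \<psi>: "\<psi> \<in> set_pmf (random_colouring n)"
    and not_sparse: "\<And>K. K \<in> ?\<C> \<Longrightarrow> \<psi> \<notin> sparse K"
    using obtain_avoiding_union_bound[OF finite_clique_families] by blast
  have "dense k pattern_density \<mu> (k - 2) (palette_hypergraph k P n \<psi>)"
    using not_sparse unfolding dense_iff_clique_families sparse_def edge_count_def by fastforce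
  then show thesis
    using that set_random_colouring[OF \<psi>] by blast
qed

lemma obtain_large_dense_palette_hypergraph:
  assumes "2 \<le> k" "0 < \<mu>"
  obtains n \<psi> where "n \<ge> n\<^sub>0" and "\<psi> \<in> nsets {1..n} (k - 1) \<rightarrow> {1..r}"
    and "dense k pattern_density \<mu> (k - 2) (palette_hypergraph k P n \<psi>)"
proof -
  obtain N :: nat where "1 / (2 * \<mu>\<^sup>2) < real N"
    using reals_Archimedean2 by blast
  define n where "n = max N (max k n\<^sub>0)"
  have "1 / (2 * \<mu>\<^sup>2) < real n"
    using \<open>1 / (2 * \<mu>\<^sup>2) < real N\<close> by (simp add: n_def)
  then have "1 < 2 * \<mu>\<^sup>2 * real n"
    using \<open>0 < \<mu>\<close> by (simp add: field_simps)
  moreover have "k \<le> n" "n\<^sub>0 \<le> n"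
    by (simp_all add: n_def)
  ultimately show thesis
    using obtain_dense_palette_hypergraph[of n \<mu>] assms that by auto
qed

end

theorem theorem1p10:
  fixes k r :: nat and F :: "'a hypergraph" and P :: "nat list set"
  assumes "k \<ge> 3"
    and "kgraph k F"
    and "r \<ge> 1"
    and "P \<subseteq> {xs. length xs = k \<and> set xs \<subseteq> {1..r}}"
    and "\<And>n \<psi>. \<psi> \<in> nsets {1..n} (k - 1) \<rightarrow> {1..r} \<Longrightarrow>
           free_of k F (palette_hypergraph k P n \<psi>)"
  shows "uniform_turan_density k (k - 2) F \<ge> real (card P) / real r ^ k"
proof -
  interpret palette k r P
    using assms(3,4) by unfold_locales
  have "pattern_density \<le> uniform_turan_density k (k - 2) F"
  proof (rule uniform_turan_density_geI[OF pattern_density_nonneg pattern_density_le_1])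
    fix \<mu> :: real and n\<^sub>0 :: nat
    assume "\<mu> > 0"
    then obtain n \<psi> where "n \<ge> n\<^sub>0" and "\<psi> \<in> nsets {1..n} (k - 1) \<rightarrow> {1..r}"
      and "dense k pattern_density \<mu> (k - 2) (palette_hypergraph k P n \<psi>)"
      using obtain_large_dense_palette_hypergraph[of \<mu> n\<^sub>0] assms(1) by auto
    then show "\<exists>H :: nat hypergraph. kgraph k H \<and> card (verts H) \<ge> n\<^sub>0 \<and> free_of k F H
        \<and> dense k pattern_density \<mu> (k - 2) H"
      using assms(5) kgraph_palette_hypergraph
      by (intro exI[of _ "palette_hypergraph k P n \<psi>"]) simp
  qed
  then show ?thesis by (simp add: pattern_density_def)
qed

end
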